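(* For every $n\ge1$ there is a bijection $f$ from the set $\mathcal{R}_n$ of restricted ascent sequences of length $n$ to the set of ascent sequences of length $n$ avoiding the pattern $021$ such that $\operatorname{asc}(f(\mathbf{x}))=\operatorname{asc}(\mathbf{x})$ for all $\mathbf{x}\in\mathcal{R}_n$. Consequently, the number of ascent sequences of length $n$ avoiding $021$ is the Catalan number $C_n=\frac{1}{n+1}\binom{2n}{n}$.
   Context: An ascent sequence is a finite sequence $x_1x_2\ldots x_n$ of nonnegative integers with $x_1=0$ and $x_i\le \operatorname{asc}(x_1\ldots x_{i-1})+1$ for all $1<i\le n$, where $\operatorname{asc}(y_1\ldots y_k)$ is the number of indices $j$ with $y_j<y_{j+1}$. A sequence avoids $021$ if there are no indices $i_1<i_2<i_3$ with $x_{i_1}<x_{i_3}<x_{i_2}$. A restricted ascent sequence is an ascent sequence $x_1\ldots x_n$ with $x_i\ge m_i-1$ for all $2\le i\le n$, where $m_i=\max(x_1,\ldots,x_{i-1})$. *)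

theory Defs
  imports Complex_Main
begin

text \<open>
  A sequence $x_1 x_2 \ldots x_n$ of nonnegative integers is a \<open>nat list\<close> of length \<open>n\<close>. List
  indices start at 0, so $x_i$ is \<open>xs ! (i - 1)\<close> and the prefix $x_1 \ldots x_{i-1}$ is
  \<open>take (i - 1) xs\<close>.
\<close>

definition asc :: "nat list \<Rightarrow> nat" where
  "asc xs = card {j. Suc j < length xs \<and> xs ! j < xs ! Suc j}"

definition ascent_sequence :: "nat list \<Rightarrow> bool" where
  "ascent_sequence xs \<longleftrightarrow>
     xs \<noteq> [] \<and> xs ! 0 = 0 \<and>
     (\<forall>i. 1 \<le> i \<and> i < length xs \<longrightarrow> xs ! i \<le> asc (take i xs) + 1)"

definition avoids_021 :: "nat list \<Rightarrow> bool" where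
  "avoids_021 xs \<longleftrightarrow>
     \<not> (\<exists>i j k. i < j \<and> j < k \<and> k < length xs \<and> xs ! i < xs ! k \<and> xs ! k < xs ! j)"

text \<open>
  The condition $x_i \ge m_i - 1$ is written over the integers, so that the subtraction is not
  truncated.
\<close>

definition restricted_ascent_sequence :: "nat list \<Rightarrow> bool" where
  "restricted_ascent_sequence xs \<longleftrightarrow>
     ascent_sequence xs \<and>
     (\<forall>i. 1 \<le> i \<and> i < length xs \<longrightarrow> int (xs ! i) \<ge> int (Max (set (take i xs))) - 1)"

definition restricted_ascent_sequences :: "nat \<Rightarrow> nat list set" where
  "restricted_ascent_sequences n = {xs. length xs = n \<and> restricted_ascent_sequence xs}"

definition ascent_sequences_avoiding_021 :: "nat \<Rightarrow> nat list set" where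
  "ascent_sequences_avoiding_021 n = {xs. length xs = n \<and> ascent_sequence xs \<and> avoids_021 xs}"

end

theory Submission
  imports Defs "HOL-Computational_Algebra.Formal_Power_Series"
begin

text \<open>
  An ascent sequence avoids 021 iff its nonzero entries increase weakly. So with \<open>m\<close> the maximum
  and \<open>a\<close> the ascent number of a prefix, the next entry ranges over \<open>{0} \<union> {m..a + 1}\<close>, whereas for
  restricted sequences it ranges over \<open>{m - 1..a + 1}\<close>. Replacing each entry below the running
  maximum by 0 matches the two choices and changes neither \<open>m\<close> nor \<open>a\<close>.

  For the count, the number of extensions of a restricted sequence depends only on \<open>m\<close>, \<open>a\<close> and
  whether the last entry is \<open>m\<close> or \<open>m - 1\<close>. If \<open>C = 1 + X C\<^sup>2\<close> and \<open>r = (1 - X) C\<^sup>2 = 1 + X C\<^sup>3\<close>, the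
  generating functions of these numbers are \<open>C\<^sup>3 r\<^bsup>a-m\<^esup>\<close> and \<open>(1 - X) C\<^sup>4 r\<^bsup>a-m\<^esup>\<close> for \<open>m > 0\<close>, and
  \<open>C\<^sup>2\<close> for \<open>m = 0\<close>: the sum over the next entry is geometric with ratio \<open>r\<close>, and \<open>r - 1 = X C\<^sup>3\<close>.
\<close>

unbundle fps_syntax

section \<open>Appending one entry: ascents, maxima and pattern avoidance\<close>

lemma asc_singleton [simp]: "asc [x] = 0"
  by (simp add: asc_def)

lemma asc_snoc:
  assumes "xs \<noteq> []"
  shows "asc (xs @ [v]) = asc xs + (if last xs < v then 1 else 0)"
proof -
  let ?A = "{j. Suc j < length xs \<and> xs ! j < xs ! Suc j}"
  let ?B = "{j. Suc j = length xs \<and> last xs < v}"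
  have "{j. Suc j < length (xs @ [v]) \<and> (xs @ [v]) ! j < (xs @ [v]) ! Suc j} = ?A \<union> ?B"
  proof -
    have "Suc j < length (xs @ [v]) \<and> (xs @ [v]) ! j < (xs @ [v]) ! Suc j \<longleftrightarrow>
        (Suc j < length xs \<and> xs ! j < xs ! Suc j) \<or> (Suc j = length xs \<and> last xs < v)" for j
    proof (cases "Suc j" "length xs" rule: linorder_cases)
      case equal
      then have "length xs - 1 = j" by simp
      with equal assms show ?thesis by (simp add: nth_append last_conv_nth)
    qed (simp_all add: nth_append)
    then show ?thesis by auto
  qed
  moreover have "finite ?A" by (rule finite_subset[of _ "{..<length xs}"]) auto
  moreover have "?B = (if last xs < v then {length xs - 1} else {})"
    using assms by (cases xs) auto
  moreover have "length xs - 1 \<notin> ?A" using assms by (cases xs) auto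
  ultimately show ?thesis
    unfolding asc_def by (cases "last xs < v") (simp_all only: if_True if_False
        Un_insert_right Un_empty_right card_insert_disjoint Suc_eq_plus1 add_0_right not_False_eq_True)
qed

lemma asc_eq_0_if_Max_eq_0:
  assumes "Max (set xs) = 0"
  shows "asc xs = 0"
proof -
  have "xs ! j = 0" if "j < length xs" for j
    using Max_ge[of "set xs" "xs ! j"] that assms by simp
  then have "{j. Suc j < length xs \<and> xs ! j < xs ! Suc j} = {}" by auto
  then show ?thesis unfolding asc_def by (simp only: card.empty)
qed

lemma ascent_sequence_nonempty: "ascent_sequence xs \<Longrightarrow> xs \<noteq> []"
  by (simp add: ascent_sequence_def)

lemma ascent_sequence_singleton [simp]: "ascent_sequence [x] \<longleftrightarrow> x = 0"
  by (auto simp: ascent_sequence_def)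

lemma ascent_sequence_snoc:
  assumes "xs \<noteq> []"
  shows "ascent_sequence (xs @ [v]) \<longleftrightarrow> ascent_sequence xs \<and> v \<le> asc xs + 1"
proof -
  have "(\<forall>i. 1 \<le> i \<and> i < length (xs @ [v]) \<longrightarrow>
            (xs @ [v]) ! i \<le> asc (take i (xs @ [v])) + 1) \<longleftrightarrow>
        (\<forall>i. 1 \<le> i \<and> i < length xs \<longrightarrow> xs ! i \<le> asc (take i xs) + 1) \<and> v \<le> asc xs + 1"
    using assms by (auto simp: nth_append less_Suc_eq Suc_le_eq)
  then show ?thesis
    using assms unfolding ascent_sequence_def by (auto simp: nth_append)
qed

lemma restricted_nonempty: "restricted_ascent_sequence xs \<Longrightarrow> xs \<noteq> []"
  by (simp add: restricted_ascent_sequence_def ascent_sequence_def)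

lemma restricted_ascent_sequence_singleton [simp]:
  "restricted_ascent_sequence [x] \<longleftrightarrow> x = 0"
  by (auto simp: restricted_ascent_sequence_def)

text \<open>The truncated \<open>Max (set xs) - 1\<close> is harmless here: when the maximum is 0,
  the integer bound -1 and the natural bound 0 are both vacuous.\<close>

lemma restricted_ascent_sequence_snoc:
  assumes "xs \<noteq> []"
  shows "restricted_ascent_sequence (xs @ [v]) \<longleftrightarrow>
    restricted_ascent_sequence xs \<and> v \<in> {Max (set xs) - 1..asc xs + 1}"
proof -
  have "(\<forall>i. 1 \<le> i \<and> i < length (xs @ [v]) \<longrightarrow>
            int ((xs @ [v]) ! i) \<ge> int (Max (set (take i (xs @ [v])))) - 1) \<longleftrightarrow>
        (\<forall>i. 1 \<le> i \<and> i < length xs \<longrightarrow> int (xs ! i) \<ge> int (Max (set (take i xs))) - 1) \<and>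
        int v \<ge> int (Max (set xs)) - 1"
    using assms by (auto simp: nth_append less_Suc_eq Suc_le_eq)
  then show ?thesis
    unfolding restricted_ascent_sequence_def ascent_sequence_snoc[OF assms] by auto
qed

lemma Max_set_snoc:
  "xs \<noteq> [] \<Longrightarrow> Max (set (xs @ [v])) = max (Max (set xs)) v"
  for xs :: "nat list"
  by (simp add: max.commute)

text \<open>A new maximum exceeds the last entry, so it creates an ascent, and it is at most the old
  ascent number plus 1.\<close>

lemma Max_le_asc:
  assumes "ascent_sequence xs"
  shows "Max (set xs) \<le> asc xs"
  using ascent_sequence_nonempty[OF assms] assms
proof (induction xs rule: rev_nonempty_induct)
  case (single x)
  then show ?case by simp
next
  case (snoc v xs)
  have arith: "max m v \<le> a + (if l < v then 1 else 0)"
    if "l \<le> m" "v \<le> a + 1" "m \<le> a" for l m a :: nat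
    using that by auto
  have "last xs \<le> Max (set xs)" using snoc.hyps by simp
  moreover have "v \<le> asc xs + 1" and "Max (set xs) \<le> asc xs"
    using snoc.prems snoc.IH unfolding ascent_sequence_snoc[OF snoc.hyps] by blast+
  ultimately have "max (Max (set xs)) v \<le> asc xs + (if last xs < v then 1 else 0)"
    by (rule arith)
  then show ?case
    unfolding Max_set_snoc[OF snoc.hyps] asc_snoc[OF snoc.hyps] .
qed

text \<open>An appended entry either becomes the maximum or is at least the old maximum minus 1.
  Hence the last entry can only be \<open>m\<close> or \<open>m - 1\<close>, which leaves few cases
  later.\<close>

lemma restricted_last_ge:
  assumes "restricted_ascent_sequence xs"
  shows "Max (set xs) - 1 \<le> last xs"
  using restricted_nonempty[OF assms] assms
proof (induction xs rule: rev_nonempty_induct)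
  case (snoc v xs)
  then show ?case
    by (auto simp: restricted_ascent_sequence_snoc Max_set_snoc simp del: set_append)
qed simp

text \<open>A new occurrence of 021 must end in \<open>v\<close>. If
  \<open>0 < v < Max (set xs)\<close>, the leading 0, an occurrence of the maximum and
  \<open>v\<close> form one; conversely \<open>v\<close> needs a smaller entry and a larger entry
  before it.\<close>

lemma avoids_021_snoc:
  assumes "xs \<noteq> []" "xs ! 0 = 0"
  shows "avoids_021 (xs @ [v]) \<longleftrightarrow> avoids_021 xs \<and> (v = 0 \<or> Max (set xs) \<le> v)"
proof (intro iffI conjI)
  assume av: "avoids_021 (xs @ [v])"
  show "avoids_021 xs"
    unfolding avoids_021_def
  proof (intro notI, elim exE conjE)
    fix i j k
    assume "i < j" "j < k" "k < length xs" "xs ! i < xs ! k" "xs ! k < xs ! j"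
    then have "\<exists>i j k. i < j \<and> j < k \<and> k < length (xs @ [v]) \<and>
        (xs @ [v]) ! i < (xs @ [v]) ! k \<and> (xs @ [v]) ! k < (xs @ [v]) ! j"
      by (intro exI[of _ i] exI[of _ j] exI[of _ k]) (simp add: nth_append)
    with av show False unfolding avoids_021_def by (rule notE)
  qed
  show "v = 0 \<or> Max (set xs) \<le> v"
  proof (rule ccontr)
    assume "\<not> (v = 0 \<or> Max (set xs) \<le> v)"
    then have neg: "0 < v" "v < Max (set xs)" by linarith+
    obtain j where j: "j < length xs" "xs ! j = Max (set xs)"
      using Max_in[of "set xs"] assms by (auto simp: in_set_conv_nth)
    have "j \<noteq> 0"
    proof
      assume "j = 0"
      with j assms have "Max (set xs) = 0" by simp
      with neg show False by simp
    qed
    then have "\<exists>i j k. i < j \<and> j < k \<and> k < length (xs @ [v]) \<and>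
        (xs @ [v]) ! i < (xs @ [v]) ! k \<and> (xs @ [v]) ! k < (xs @ [v]) ! j"
      using neg j(1) assms unfolding j(2)[symmetric]
      by (intro exI[of _ 0] exI[of _ j] exI[of _ "length xs"]) (simp add: nth_append)
    with av show False unfolding avoids_021_def by (rule notE)
  qed
next
  assume av: "avoids_021 xs \<and> (v = 0 \<or> Max (set xs) \<le> v)"
  show "avoids_021 (xs @ [v])"
    unfolding avoids_021_def
  proof (intro notI, elim exE conjE)
    fix i j k
    assume ijk: "i < j" "j < k" "k < length (xs @ [v])"
      "(xs @ [v]) ! i < (xs @ [v]) ! k" "(xs @ [v]) ! k < (xs @ [v]) ! j"
    show False
    proof (cases "k < length xs")
      case True
      then show False using ijk av by (auto simp: avoids_021_def nth_append)
    next
      case False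
      then have "xs ! j \<le> Max (set xs)" "0 < v" "v < xs ! j"
        using ijk by (auto simp: nth_append)
      then show False using av by auto
    qed
  qed
qed

section \<open>The bijection\<close>

text \<open>The prefix \<open>take (Suc i) xs\<close> includes entry \<open>i\<close> itself. This
  does not affect the strict comparison and keeps the set under \<open>Max\<close> nonempty at
  \<open>i = 0\<close>.\<close>

definition flatten_below_max :: "nat list \<Rightarrow> nat list" where
  "flatten_below_max xs =
     map (\<lambda>i. if xs ! i < Max (set (take (Suc i) xs)) then 0 else xs ! i) [0..<length xs]"

lemma length_flatten_below_max [simp]: "length (flatten_below_max xs) = length xs"
  by (simp add: flatten_below_max_def)

lemma flatten_below_max_eq_Nil [simp]: "flatten_below_max xs = [] \<longleftrightarrow> xs = []"
  by (simp add: flatten_below_max_def)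

lemma flatten_below_max_singleton [simp]: "flatten_below_max [x] = [x]"
  by (simp add: flatten_below_max_def)

lemma flatten_below_max_snoc:
  assumes "xs \<noteq> []"
  shows "flatten_below_max (xs @ [v]) =
    flatten_below_max xs @ [if v < Max (set xs) then 0 else v]"
  using assms by (auto simp: flatten_below_max_def nth_append)

lemma last_flatten_below_max:
  "xs \<noteq> [] \<Longrightarrow>
    last (flatten_below_max xs) = (if last xs < Max (set xs) then 0 else last xs)"
  by (simp add: flatten_below_max_def last_map last_conv_nth)

lemma Max_flatten_below_max:
  "xs \<noteq> [] \<Longrightarrow> Max (set (flatten_below_max xs)) = Max (set xs)"
proof (induction xs rule: rev_nonempty_induct)
  case (snoc v xs)
  then show ?case
    by (auto simp: flatten_below_max_snoc Max_set_snoc simp del: set_append)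
qed simp

text \<open>With maximum \<open>m\<close>, the last entry and \<open>v\<close> are both at least
  \<open>m - 1\<close>. After last entry \<open>m\<close>, an ascent means \<open>v > m\<close>, and
  such a \<open>v\<close> is kept. After \<open>m - 1 < m\<close>, which became 0, an ascent means
  \<open>v \<ge> m\<close>, exactly when the new image entry is nonzero.\<close>

lemma asc_flatten_below_max:
  assumes "restricted_ascent_sequence xs"
  shows "asc (flatten_below_max xs) = asc xs"
  using restricted_nonempty[OF assms] assms
proof (induction xs rule: rev_nonempty_induct)
  case (snoc v xs)
  then have r: "restricted_ascent_sequence xs" "Max (set xs) - 1 \<le> v"
    by (auto simp: restricted_ascent_sequence_snoc)
  have "last xs \<le> Max (set xs)" using snoc.hyps by simp
  with restricted_last_ge[OF r(1)] r snoc show ?case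
    by (auto simp: flatten_below_max_snoc asc_snoc last_flatten_below_max)
qed simp

lemma restricted_ascent_sequences_1: "restricted_ascent_sequences (Suc 0) = {[0]}"
  by (auto simp: restricted_ascent_sequences_def length_Suc_conv)

lemma ascent_sequences_avoiding_021_1: "ascent_sequences_avoiding_021 (Suc 0) = {[0]}"
  by (auto simp: ascent_sequences_avoiding_021_def length_Suc_conv avoids_021_def)

text \<open>The dependent sum over prefixes serves both the fibrewise bijection and the double sum
  in the count.\<close>

lemma restricted_ascent_sequences_Suc:
  assumes "n \<ge> 1"
  shows "restricted_ascent_sequences (Suc n) =
    (\<lambda>(xs, v). xs @ [v]) `
      (SIGMA xs : restricted_ascent_sequences n. {Max (set xs) - 1..asc xs + 1})"
    (is "?L = ?f ` ?S")
proof (intro set_eqI iffI)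
  fix ys assume "ys \<in> ?L"
  then obtain xs v where ys: "ys = xs @ [v]" "length xs = n" "restricted_ascent_sequence ys"
    by (auto simp: restricted_ascent_sequences_def length_Suc_conv_rev)
  then have "xs \<noteq> []" using assms by auto
  with ys have "(xs, v) \<in> ?S"
    by (auto simp: restricted_ascent_sequences_def restricted_ascent_sequence_snoc)
  with ys show "ys \<in> ?f ` ?S" by force
next
  fix ys assume "ys \<in> ?f ` ?S"
  then obtain xs v where "ys = xs @ [v]" "(xs, v) \<in> ?S" by auto
  moreover from this have "xs \<noteq> []" using assms by (auto simp: restricted_ascent_sequences_def)
  ultimately show "ys \<in> ?L"
    by (auto simp: restricted_ascent_sequences_def restricted_ascent_sequence_snoc)
qed

lemma ascent_sequences_avoiding_021_Suc:
  assumes "n \<ge> 1"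
  shows "ascent_sequences_avoiding_021 (Suc n) =
    (\<lambda>(xs, v). xs @ [v]) `
      (SIGMA xs : ascent_sequences_avoiding_021 n. insert 0 {Max (set xs)..asc xs + 1})"
    (is "?L = ?f ` ?S")
proof (intro set_eqI iffI)
  fix ys assume "ys \<in> ?L"
  then obtain xs v where ys: "ys = xs @ [v]" "length xs = n" "ascent_sequence ys" "avoids_021 ys"
    by (auto simp: ascent_sequences_avoiding_021_def length_Suc_conv_rev)
  then have "xs \<noteq> []" using assms by auto
  moreover from this ys have "ascent_sequence xs" "v \<le> asc xs + 1"
    by (simp_all add: ascent_sequence_snoc)
  moreover from this have "xs ! 0 = 0" by (simp add: ascent_sequence_def)
  ultimately have "(xs, v) \<in> ?S"
    using ys by (auto simp: ascent_sequences_avoiding_021_def avoids_021_snoc)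
  with ys show "ys \<in> ?f ` ?S" by force
next
  fix ys assume "ys \<in> ?f ` ?S"
  then obtain xs v where xv: "ys = xs @ [v]" "(xs, v) \<in> ?S" by auto
  then have "ascent_sequence xs" by (auto simp: ascent_sequences_avoiding_021_def)
  then have "xs \<noteq> []" "xs ! 0 = 0" by (simp_all add: ascent_sequence_def)
  with xv show "ys \<in> ?L"
    by (auto simp: ascent_sequences_avoiding_021_def ascent_sequence_snoc avoids_021_snoc)
qed

text \<open>Induction on the length: the prefixes are matched by the induction hypothesis, the last
  entries by a bijection for each prefix.\<close>

lemma bij_betw_flatten_below_max:
  "n \<ge> 1 \<Longrightarrow>
    bij_betw flatten_below_max (restricted_ascent_sequences n) (ascent_sequences_avoiding_021 n)"
proof (induction n rule: dec_induct)
  case base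
  then show ?case
    by (simp add: restricted_ascent_sequences_1 ascent_sequences_avoiding_021_1)
next
  case (step n)
  let ?R = "restricted_ascent_sequences" and ?A = "ascent_sequences_avoiding_021"
  let ?V = "\<lambda>xs. {Max (set xs) - 1..asc xs + 1}"
  let ?W = "\<lambda>xs. insert 0 {Max (set xs)..asc xs + 1}"
  let ?g = "\<lambda>xs v. if v < Max (set xs) then 0 else v"
  let ?h = "\<lambda>(xs, v). (flatten_below_max xs, ?g xs v)"
  let ?snoc = "\<lambda>(xs, v). xs @ [v]"
  have inj_snoc: "inj_on ?snoc S" for S :: "(nat list \<times> nat) set"
    by (auto simp: inj_on_def)
  have fibre: "bij_betw (?g xs) (?V xs) (?W xs)" if "xs \<in> ?R n" for xs
  proof -
    have "Max (set xs) \<le> asc xs"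
      using that by (intro Max_le_asc)
        (simp add: restricted_ascent_sequences_def restricted_ascent_sequence_def)
    \<comment> \<open>Only \<open>m - 1\<close> and 0 are exchanged, so the inverse sends entries
      below \<open>m\<close> back to \<open>m - 1\<close>. For \<open>m = 0\<close> both maps are
      the identity. The bound \<open>m \<le> asc xs\<close> puts \<open>m - 1\<close> into the
      interval.\<close>
    then show ?thesis
      by (intro bij_betw_byWitness
          [where f' = "\<lambda>w. if w < Max (set xs) then Max (set xs) - 1 else w"]) auto
  qed
  have nonempty: "xs \<noteq> []" if "xs \<in> ?R n" for xs
    using that step.hyps by (auto simp: restricted_ascent_sequences_def)
  \<comment> \<open>The image prefix has the same maximum and ascent number, hence the same
    admissible entries.\<close>
  have W: "?W (flatten_below_max xs) = ?W xs" if "xs \<in> ?R n" for xs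
    using that nonempty[OF that]
    by (simp add: Max_flatten_below_max asc_flatten_below_max restricted_ascent_sequences_def)
  have "bij_betw ?h (Sigma (?R n) ?V) (Sigma (?A n) ?W)"
    unfolding bij_betw_def
  proof
    show "inj_on ?h (Sigma (?R n) ?V)"
    proof (rule inj_onI)
      fix p q
      assume "p \<in> Sigma (?R n) ?V" "q \<in> Sigma (?R n) ?V" "?h p = ?h q"
      then obtain xs u ys v where pq: "p = (xs, u)" "q = (ys, v)"
        "xs \<in> ?R n" "ys \<in> ?R n" "u \<in> ?V xs" "v \<in> ?V ys"
        "flatten_below_max xs = flatten_below_max ys" "?g xs u = ?g ys v"
        by (elim SigmaE) simp
      then have "xs = ys"
        using inj_onD[OF bij_betw_imp_inj_on[OF step.IH]] by blast
      with pq show "p = q"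
        using inj_onD[OF bij_betw_imp_inj_on[OF fibre[OF pq(3)]]] by blast
    qed
    show "?h ` Sigma (?R n) ?V = Sigma (?A n) ?W"
    proof (intro set_eqI iffI)
      fix p assume "p \<in> ?h ` Sigma (?R n) ?V"
      then obtain xs v where p: "p = (flatten_below_max xs, ?g xs v)" "xs \<in> ?R n" "v \<in> ?V xs"
        by auto
      then have "flatten_below_max xs \<in> ?A n" "?g xs v \<in> ?W xs"
        using bij_betw_apply[OF step.IH] bij_betw_apply[OF fibre[OF p(2)]] by blast+
      with p W show "p \<in> Sigma (?A n) ?W" by blast
    next
      fix p assume "p \<in> Sigma (?A n) ?W"
      then obtain ys w where p: "p = (ys, w)" "ys \<in> ?A n" "w \<in> ?W ys" by blast
      then obtain xs where xs: "xs \<in> ?R n" "ys = flatten_below_max xs"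
        using step.IH by (auto simp: bij_betw_def)
      with p W have "w \<in> ?W xs" by blast
      then obtain v where "v \<in> ?V xs" "w = ?g xs v"
        using fibre[OF xs(1)] unfolding bij_betw_def by blast
      with p(1) xs show "p \<in> ?h ` Sigma (?R n) ?V"
        by (intro image_eqI[of _ _ "(xs, v)"] SigmaI) simp_all
    qed
  qed
  then have "bij_betw (?snoc \<circ> ?h) (Sigma (?R n) ?V) (?A (Suc n))"
    unfolding ascent_sequences_avoiding_021_Suc[OF step.hyps(1)]
    by (rule bij_betw_trans) (simp add: bij_betw_def inj_snoc)
  \<comment> \<open>Flattening commutes with appending, so the bijection on pairs carries over along
    the injective \<open>?snoc\<close>.\<close>
  moreover have "(?snoc \<circ> ?h) p = (flatten_below_max \<circ> ?snoc) p" if "p \<in> Sigma (?R n) ?V" for p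
    using that nonempty by (auto simp: flatten_below_max_snoc)
  ultimately have "bij_betw (flatten_below_max \<circ> ?snoc) (Sigma (?R n) ?V) (?A (Suc n))"
    using bij_betw_cong by blast
  then show ?case
    unfolding restricted_ascent_sequences_Suc[OF step.hyps(1)]
    using bij_betw_comp_iff[OF inj_on_imp_bij_betw[OF inj_snoc]] by blast
qed

section \<open>The quadratic equation of the Catalan series\<close>

definition catalan_fps :: "real fps" where
  "catalan_fps = Abs_fps (\<lambda>n. real ((2 * n) choose n) / (real n + 1))"

text \<open>Absorption is applied twice, passing through \<open>(2 * n + 1) choose n\<close>; a
  common factor \<open>n + 1\<close> is then cancelled.\<close>

lemma Suc_mult_central_binomial_Suc:
  "(n + 1) * ((2 * Suc n) choose Suc n) = 2 * (2 * n + 1) * ((2 * n) choose n)"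
proof -
  have "(n + 1) * ((2 * Suc n) choose Suc n) = (2 * n + 2) * ((2 * n + 1) choose n)"
    using Suc_times_binomial_eq[of "2 * n + 1" n] by (simp add: mult.commute)
  moreover have "(n + 1) * ((2 * n + 1) choose n) = (2 * n + 1) * ((2 * n) choose n)"
    using Suc_times_binomial_eq[of "2 * n" n] binomial_symmetric[of n "2 * n + 1"]
    by (simp add: mult.commute)
  ultimately have "(n + 1) * ((n + 1) * ((2 * Suc n) choose Suc n)) =
      (n + 1) * (2 * (2 * n + 1) * ((2 * n) choose n))"
    by (simp add: algebra_simps)
  then show ?thesis by (metis Suc_eq_plus1 mult_cancel1 nat.simps(3))
qed

text \<open>These are the coefficients of sqrt(1 - 4X) beyond the constant one. Both sides satisfy
  \<open>u (n + 1) * (n + 2) = 2 * (2 * n + 1) * u n\<close>; on the left, the factor is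
  \<open>-4 * (1 / 2 - (n + 1))\<close>.\<close>

lemma half_gbinomial_Suc:
  "(1 / 2 gchoose Suc n) * (- 4) ^ Suc n = - 2 * catalan_fps $ n"
proof (induction n)
  case 0
  then show ?case by (simp add: catalan_fps_def)
next
  case (Suc n)
  have central: "(real n + 1) * real ((2 * Suc n) choose Suc n) =
      2 * (2 * real n + 1) * real ((2 * n) choose n)"
    using arg_cong[OF Suc_mult_central_binomial_Suc[of n], of real]
    by (simp only: of_nat_mult of_nat_add of_nat_1 of_nat_numeral)
  have "y / (real (Suc n) + 1) * (real n + 2) = 2 * (2 * real n + 1) * (x / (real n + 1))"
    if "(real n + 1) * y = 2 * (2 * real n + 1) * x" for x y :: real
  proof -
    have "y / (real (Suc n) + 1) * (real n + 2) = y" by (simp add: field_simps)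
    also have "\<dots> = 2 * (2 * real n + 1) * (x / (real n + 1))"
      unfolding times_divide_eq_right that[symmetric] by simp
    finally show ?thesis .
  qed
  from this[OF central]
  have "catalan_fps $ Suc n * (real n + 2) = 2 * (2 * real n + 1) * catalan_fps $ n"
    by (simp only: catalan_fps_def fps_nth_Abs_fps)
  moreover have "(1 / 2 gchoose Suc (Suc n)) * (- 4) ^ Suc (Suc n) * (real n + 2) =
      (1 / 2 gchoose Suc n) * (- 4) ^ Suc n * (2 * (2 * real n + 1))"
  proof -
    have absorb: "(1 / 2 gchoose Suc (Suc n)) * (real n + 2) =
        (1 / 2 gchoose Suc n) * (1 / 2 - real (Suc n))"
    proof -
      have "real (Suc (Suc n)) * (1 / 2 gchoose Suc (Suc n)) =
          (1 / 2 - real (Suc n)) * (1 / 2 gchoose Suc n)"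
        unfolding gbinomial_absorption gbinomial_absorb_comp ..
      moreover have "real (Suc (Suc n)) = real n + 2" by simp
      ultimately show ?thesis by (simp only: mult.commute)
    qed
    have "h * (- 4 * p) * (real n + 2) = g * p * (2 * (2 * real n + 1))"
      if "h * (real n + 2) = g * (1 / 2 - real (Suc n))" for g h p :: real
    proof -
      have "h * (- 4 * p) * (real n + 2) = (- 4 * p) * (h * (real n + 2))"
        by (simp only: mult_ac)
      also have "\<dots> = g * p * (2 * (2 * real n + 1))"
        unfolding that by (simp add: algebra_simps)
      finally show ?thesis .
    qed
    from this[OF absorb] show ?thesis by (simp only: power_Suc[of _ "Suc n"])
  qed
  ultimately have "(1 / 2 gchoose Suc (Suc n)) * (- 4) ^ Suc (Suc n) * (real n + 2) =
      (- 2 * catalan_fps $ Suc n) * (real n + 2)"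
    by (simp only: Suc.IH mult_ac)
  moreover have "real n + 2 \<noteq> 0" by simp
  note mult_right_cancel[OF this]
  ultimately show ?case by (rule iffD1[rotated])
qed

text \<open>The closed form is the expansion of \<open>1 - 2 X C = sqrt (1 - 4 X)\<close>.\<close>

lemma catalan_fps_eq: "catalan_fps = 1 + fps_X * catalan_fps\<^sup>2"
proof -
  let ?C = catalan_fps
  \<comment> \<open>\<open>B\<close> is the square root of 1 + X; substituting -4X for X makes
    \<open>G\<close> the square root of 1 - 4X.\<close>
  define B where "B = fps_binomial (1 / 2 :: real)"
  define G where "G = B oo (fps_const (- 4) * fps_X)"
  have G_nth: "G $ n = (1 / 2 gchoose n) * (- 4) ^ n" for n
    unfolding G_def B_def fps_compose_linear by simp
  have "G = 1 - fps_const 2 * fps_X * ?C"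
  proof (rule fps_ext)
    fix n
    show "G $ n = (1 - fps_const 2 * fps_X * ?C) $ n"
    proof (cases n)
      case (Suc k)
      show ?thesis
        unfolding Suc G_nth half_gbinomial_Suc by (simp add: mult.assoc)
    qed (simp add: G_nth mult.assoc)
  qed
  moreover have "B * B = 1 + fps_X"
    unfolding B_def by (simp add: fps_binomial_add_mult[symmetric] fps_binomial_1)
  then have "G * G = 1 + fps_const (- 4) * fps_X"
    unfolding G_def by (simp add: fps_compose_mult_distrib[symmetric] fps_compose_add_distrib)
  ultimately have "(1 - fps_const 2 * fps_X * ?C) * (1 - fps_const 2 * fps_X * ?C) =
      1 + fps_const (- 4) * fps_X"
    by simp
  moreover have "fps_const 2 = (2 :: real fps)" "fps_const (- 4) = (- 4 :: real fps)"
    by (simp_all add: numeral_fps_const fps_const_neg[symmetric] del: fps_const_neg)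
  \<comment> \<open>Expanding the square leaves a multiple of 4X, which cancels because real power
    series have no zero divisors.\<close>
  ultimately have "4 * fps_X * (1 + fps_X * ?C\<^sup>2 - ?C) = 0"
    by (simp add: algebra_simps power2_eq_square)
  then show ?thesis by simp
qed

section \<open>Generating functions of extensions\<close>

definition catalan_ratio :: "real fps" where
  "catalan_ratio = (1 - fps_X) * catalan_fps\<^sup>2"

text \<open>By \<open>X * C^2 = C - 1\<close>, both sides equal \<open>C^2 - C + 1\<close>.\<close>

lemma catalan_ratio_eq: "catalan_ratio = 1 + fps_X * catalan_fps ^ 3"
proof -
  have "(1 - X) * C\<^sup>2 = 1 + X * C ^ 3" if "C = 1 + X * C\<^sup>2" for C X :: "real fps"
    using that by algebra
  from this[OF catalan_fps_eq] show ?thesis by (simp add: catalan_ratio_def)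
qed

text \<open>Downward induction from the empty sum at \<open>p = Suc q\<close>: the term for
  \<open>p\<close> turns \<open>r^(q - p)\<close> into \<open>(1 + X * C^3) * r^(q - p)\<close>,
  which is the next power.\<close>

lemma geometric_catalan_ratio:
  assumes "p \<le> Suc q"
  shows "1 + fps_X * (\<Sum>v = p..q. catalan_fps ^ 3 * catalan_ratio ^ (q - v)) =
    catalan_ratio ^ (Suc q - p)"
  using assms
proof (induction p rule: inc_induct)
  case base
  then show ?case by simp
next
  case (step p)
  then have "(\<Sum>v = p..q. catalan_fps ^ 3 * catalan_ratio ^ (q - v)) =
      catalan_fps ^ 3 * catalan_ratio ^ (q - p) +
      (\<Sum>v = Suc p..q. catalan_fps ^ 3 * catalan_ratio ^ (q - v))"
    by (simp add: sum.atLeast_Suc_atMost)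
  then have "1 + fps_X * (\<Sum>v = p..q. catalan_fps ^ 3 * catalan_ratio ^ (q - v)) =
      fps_X * catalan_fps ^ 3 * catalan_ratio ^ (q - p) +
      (1 + fps_X * (\<Sum>v = Suc p..q. catalan_fps ^ 3 * catalan_ratio ^ (q - v)))"
    by (simp add: algebra_simps)
  also have "\<dots> = (1 + fps_X * catalan_fps ^ 3) * catalan_ratio ^ (q - p)"
    unfolding step.IH by (simp add: algebra_simps)
  also have "\<dots> = catalan_ratio ^ (Suc q - p)"
    unfolding catalan_ratio_eq[symmetric] using step.hyps by (simp add: Suc_diff_le)
  finally show ?case .
qed

text \<open>The coefficient of \<open>X\<^sup>k\<close> is the number of ways to append \<open>k\<close> entries to \<open>xs\<close>.\<close>

definition extension_fps :: "nat list \<Rightarrow> real fps" where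
  "extension_fps xs = (let m = Max (set xs) in
     if m = 0 then catalan_fps\<^sup>2
     else (if last xs = m then catalan_fps ^ 3 else (1 - fps_X) * catalan_fps ^ 4) *
       catalan_ratio ^ (asc xs - m))"

text \<open>The closed forms obey the recursion of the counts: 1 stands for the empty extension, X
  for the next entry \<open>v\<close>.\<close>

lemma extension_fps_rec:
  assumes "restricted_ascent_sequence xs"
  shows "extension_fps xs =
    1 + fps_X * (\<Sum>v = Max (set xs) - 1..asc xs + 1. extension_fps (xs @ [v]))"
proof -
  let ?C = catalan_fps and ?r = catalan_ratio
  define m where "m = Max (set xs)"
  define a where "a = asc xs"
  have ne: "xs \<noteq> []" and asq: "ascent_sequence xs"
    using assms by (auto simp: restricted_ascent_sequence_def ascent_sequence_def)
  have "m \<le> a" using Max_le_asc[OF asq] by (simp add: m_def a_def)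
  have last: "m - 1 \<le> last xs" "last xs \<le> m"
    using restricted_last_ge[OF assms] ne by (simp_all add: m_def)
  have nil: "extension_fps xs = (if m = 0 then ?C\<^sup>2
      else (if last xs = m then ?C ^ 3 else (1 - fps_X) * ?C ^ 4) * ?r ^ (a - m))"
    by (simp only: extension_fps_def Let_def m_def a_def)
  have snoc: "extension_fps (xs @ [v]) = (if max m v = 0 then ?C\<^sup>2
      else (if v = max m v then ?C ^ 3 else (1 - fps_X) * ?C ^ 4) *
        ?r ^ (a + (if last xs < v then 1 else 0) - max m v))" for v
    unfolding extension_fps_def Let_def Max_set_snoc[OF ne] asc_snoc[OF ne] last_snoc
      m_def[symmetric] a_def[symmetric] ..
  \<comment> \<open>Such a \<open>v\<close> creates an ascent and is the new maximum, so the state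
    becomes maximum \<open>v\<close>, ascent number \<open>a + 1\<close>, last entry
    maximal.\<close>
  have up: "extension_fps (xs @ [v]) = ?C ^ 3 * ?r ^ (a + 1 - v)"
    if "last xs < v" "m \<le> v" for v
  proof -
    have "max m v = v" "v \<noteq> 0" using that by auto
    with that(1) show ?thesis by (simp only: snoc if_True if_False refl)
  qed
  have "extension_fps xs = 1 + fps_X * (\<Sum>v = m - 1..a + 1. extension_fps (xs @ [v]))"
  \<comment> \<open>With \<open>m = 0\<close> the prefix is all zeros. Appending 0 keeps it so;
    appending 1 leads to \<open>m = a = 1\<close>. The claim is then \<open>catalan_ratio_eq\<close>
    rearranged.\<close>
  proof (cases "m = 0")
    case True
    then have "a = 0" using asc_eq_0_if_Max_eq_0 by (simp only: m_def a_def)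
    have "{m - 1..a + 1} = {0, 1}" using True \<open>a = 0\<close> by auto
    moreover have "extension_fps (xs @ [0]) = ?C\<^sup>2" by (simp add: snoc True)
    moreover have "extension_fps (xs @ [1]) = ?C ^ 3"
      using up[of 1] last True \<open>a = 0\<close> by simp
    ultimately have sum: "(\<Sum>v = m - 1..a + 1. extension_fps (xs @ [v])) = ?C\<^sup>2 + ?C ^ 3"
      by simp
    have "extension_fps xs = ?C\<^sup>2" by (simp add: nil True)
    also have "\<dots> = 1 + fps_X * (?C\<^sup>2 + ?C ^ 3)"
      using catalan_ratio_eq unfolding catalan_ratio_def by algebra
    finally show ?thesis unfolding sum .
  next
    case False
    have peel: "1 + fps_X * (p + q) = fps_X * p + (1 + fps_X * q)" for p q :: "real fps"
      by (simp add: algebra_simps)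
    let ?L = "(1 - fps_X) * ?C ^ 4 * ?r ^ (a - m)"
    \<comment> \<open>Appending \<open>m - 1\<close> creates no ascent and keeps \<open>m\<close>
      and \<open>a\<close>.\<close>
    have low: "extension_fps (xs @ [m - 1]) = ?L"
    proof -
      have "max m (m - 1) = m" "m - 1 \<noteq> m" "\<not> last xs < m - 1" using False last by auto
      with False show ?thesis by (simp only: snoc if_True if_False add_0_right)
    qed
    have "{m - 1..a + 1} = insert (m - 1) {m..a + 1}" "m - 1 \<notin> {m..a + 1}"
      using False \<open>m \<le> a\<close> by auto
    then have split: "(\<Sum>v = m - 1..a + 1. extension_fps (xs @ [v])) =
        ?L + (\<Sum>v = m..a + 1. extension_fps (xs @ [v]))"
      by (simp only: sum.insert finite_atLeastAtMost low not_False_eq_True)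
    show ?thesis
    proof (cases "last xs = m")
      \<comment> \<open>Here \<open>m\<close> creates no ascent either, so the geometric sum starts
        at \<open>Suc m\<close> and gives \<open>r^(a - m + 1)\<close>.\<close>
      case True
      have "(\<Sum>v = Suc m..a + 1. extension_fps (xs @ [v])) =
          (\<Sum>v = Suc m..a + 1. ?C ^ 3 * ?r ^ (a + 1 - v))"
        using True by (intro sum.cong[OF refl] up) simp_all
      moreover have "Suc (a + 1) - Suc m = Suc (a - m)" using \<open>m \<le> a\<close> by simp
      moreover have "Suc m \<le> Suc (a + 1)" using \<open>m \<le> a\<close> by simp
      note geometric_catalan_ratio[OF this]
      ultimately have
        "1 + fps_X * (\<Sum>v = Suc m..a + 1. extension_fps (xs @ [v])) = ?r ^ Suc (a - m)"
        by (simp only:)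
      moreover have "extension_fps (xs @ [m]) = ?C ^ 3 * ?r ^ (a - m)"
        using True False by (simp add: snoc)
      moreover have "(\<Sum>v = m..a + 1. extension_fps (xs @ [v])) =
          extension_fps (xs @ [m]) + (\<Sum>v = Suc m..a + 1. extension_fps (xs @ [v]))"
        using \<open>m \<le> a\<close> by (intro sum.atLeast_Suc_atMost) simp
      ultimately have "1 + fps_X * (\<Sum>v = m - 1..a + 1. extension_fps (xs @ [v])) =
          fps_X * (?L + ?C ^ 3 * ?r ^ (a - m)) + ?r ^ Suc (a - m)"
        by (simp only: split add.assoc[symmetric] peel)
      also have "\<dots> = (fps_X * ((1 - fps_X) * ?C ^ 4 + ?C ^ 3) + ?r) * ?r ^ (a - m)"
        by (simp only: power_Suc distrib_left distrib_right mult.assoc)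
      also have "fps_X * ((1 - fps_X) * ?C ^ 4 + ?C ^ 3) + ?r = ?C ^ 3"
      proof -
        have "X * ((1 - X) * C ^ 4 + C ^ 3) + (1 - X) * C\<^sup>2 = C ^ 3"
          if "C = 1 + X * C\<^sup>2" for C X :: "real fps"
          using that by algebra
        from this[OF catalan_fps_eq] show ?thesis by (simp only: catalan_ratio_def)
      qed
      finally show ?thesis
        using True False by (simp only: nil refl if_True if_False)
    next
      \<comment> \<open>The last entry is now \<open>m - 1\<close>, so appending \<open>m\<close> is
        already an ascent; the sum starts at \<open>m\<close> and gives
        \<open>r^(a - m + 2)\<close>.\<close>
      case low: False
      with last have "last xs < m" by simp
      then have "(\<Sum>v = m..a + 1. extension_fps (xs @ [v])) =
          (\<Sum>v = m..a + 1. ?C ^ 3 * ?r ^ (a + 1 - v))"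
        by (intro sum.cong[OF refl] up) simp_all
      moreover have "Suc (a + 1) - m = (a - m) + 2" using \<open>m \<le> a\<close> by simp
      moreover have "m \<le> Suc (a + 1)" using \<open>m \<le> a\<close> by simp
      note geometric_catalan_ratio[OF this]
      ultimately have
        "1 + fps_X * (\<Sum>v = m..a + 1. extension_fps (xs @ [v])) = ?r ^ (a - m) * ?r\<^sup>2"
        by (simp only: power_add)
      then have "1 + fps_X * (\<Sum>v = m - 1..a + 1. extension_fps (xs @ [v])) =
          fps_X * ?L + ?r ^ (a - m) * ?r\<^sup>2"
        by (simp only: split peel)
      also have "\<dots> = (fps_X * (1 - fps_X) * ?C ^ 4 + ?r\<^sup>2) * ?r ^ (a - m)"
        by (simp only: distrib_right mult.assoc mult.commute[of "?r ^ (a - m)"])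
      also have "fps_X * (1 - fps_X) * ?C ^ 4 + ?r\<^sup>2 = (1 - fps_X) * ?C ^ 4"
        unfolding catalan_ratio_def by algebra
      finally show ?thesis
        using low False by (simp only: nil if_False)
    qed
  qed
  then show ?thesis by (simp only: m_def a_def)
qed

section \<open>The Catalan count\<close>

lemma finite_restricted_ascent_sequences:
  "n \<ge> 1 \<Longrightarrow> finite (restricted_ascent_sequences n)"
proof (induction n rule: dec_induct)
  case base
  then show ?case by (simp add: restricted_ascent_sequences_1)
next
  case (step n)
  then show ?case by (auto simp: restricted_ascent_sequences_Suc intro!: finite_SigmaI)
qed

text \<open>The recursion trades one unit of \<open>k\<close> for one unit of length, so the sum
  depends only on \<open>n + k\<close>; hence \<open>k\<close> is arbitrary in the
  induction.\<close>

lemma sum_extension_fps: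
  assumes "n \<ge> 1"
  shows "(\<Sum>xs \<in> restricted_ascent_sequences n. extension_fps xs $ k) =
    catalan_fps $ (n + k)"
  using assms
proof (induction n arbitrary: k rule: dec_induct)
  case base
  \<comment> \<open>The sequence \<open>[0]\<close> has series \<open>C^2\<close>, and
    \<open>C - 1 = X * C^2\<close> shifts its coefficients to those of \<open>C\<close>.\<close>
  have "(catalan_fps - 1) $ Suc k = (fps_X * catalan_fps\<^sup>2) $ Suc k"
    using catalan_fps_eq by (metis add_diff_cancel_left')
  then show ?case
    by (simp add: restricted_ascent_sequences_1 extension_fps_def)
next
  case (step n)
  let ?V = "\<lambda>xs. {Max (set xs) - 1..asc xs + 1}"
  have "(\<Sum>ys \<in> restricted_ascent_sequences (Suc n). extension_fps ys $ k) =
      (\<Sum>(xs, v) \<in> Sigma (restricted_ascent_sequences n) ?V. extension_fps (xs @ [v]) $ k)"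
    unfolding restricted_ascent_sequences_Suc[OF step.hyps(1)]
    by (subst sum.reindex) (auto simp: inj_on_def case_prod_unfold)
  also have "\<dots> = (\<Sum>xs \<in> restricted_ascent_sequences n. \<Sum>v \<in> ?V xs. extension_fps (xs @ [v]) $ k)"
    using finite_restricted_ascent_sequences[OF step.hyps(1)] by (subst sum.Sigma) auto
  also have "\<dots> = (\<Sum>xs \<in> restricted_ascent_sequences n. extension_fps xs $ Suc k)"
  proof (rule sum.cong[OF refl])
    fix xs assume "xs \<in> restricted_ascent_sequences n"
    then have "extension_fps xs = 1 + fps_X * (\<Sum>v \<in> ?V xs. extension_fps (xs @ [v]))"
      by (intro extension_fps_rec) (simp add: restricted_ascent_sequences_def)
    then have "extension_fps xs $ Suc k =
        (1 + fps_X * (\<Sum>v \<in> ?V xs. extension_fps (xs @ [v]))) $ Suc k"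
      by (rule arg_cong)
    then show "(\<Sum>v \<in> ?V xs. extension_fps (xs @ [v]) $ k) = extension_fps xs $ Suc k"
      by (simp add: fps_sum_nth)
  qed
  also have "\<dots> = catalan_fps $ (Suc n + k)"
    using step.IH[of "Suc k"] by simp
  finally show ?case .
qed

text \<open>At \<open>k = 0\<close> each sequence contributes the constant term 1 of its
  series.\<close>

lemma card_restricted_ascent_sequences:
  assumes "n \<ge> 1"
  shows "real (card (restricted_ascent_sequences n)) = catalan_fps $ n"
proof -
  have "extension_fps xs $ 0 = 1" if "xs \<in> restricted_ascent_sequences n" for xs
  proof -
    have "restricted_ascent_sequence xs"
      using that by (simp add: restricted_ascent_sequences_def)
    from arg_cong[OF extension_fps_rec[OF this], of "\<lambda>F. F $ 0"] show ?thesis by simp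
  qed
  then show ?thesis
    using sum_extension_fps[OF assms, of 0] by simp
qed

theorem theorem2p11:
  fixes n :: nat
  assumes "n \<ge> 1"
  shows "(\<exists>f. bij_betw f (restricted_ascent_sequences n) (ascent_sequences_avoiding_021 n) \<and>
              (\<forall>xs \<in> restricted_ascent_sequences n. asc (f xs) = asc xs)) \<and>
         real (card (ascent_sequences_avoiding_021 n)) =
           1 / (real n + 1) * real ((2 * n) choose n)"
proof
  have bij: "bij_betw flatten_below_max (restricted_ascent_sequences n)
      (ascent_sequences_avoiding_021 n)"
    using bij_betw_flatten_below_max[OF assms] .
  then show "\<exists>f. bij_betw f (restricted_ascent_sequences n) (ascent_sequences_avoiding_021 n) \<and>
      (\<forall>xs \<in> restricted_ascent_sequences n. asc (f xs) = asc xs)"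
    using asc_flatten_below_max by (auto simp: restricted_ascent_sequences_def)
  show "real (card (ascent_sequences_avoiding_021 n)) =
      1 / (real n + 1) * real ((2 * n) choose n)"
    using card_restricted_ascent_sequences[OF assms] bij_betw_same_card[OF bij]
    by (simp add: catalan_fps_def)
qed

end
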